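(* Let $n$ and $k$ be positive integers. The map $(\mathcal P_1,\mathcal P_2,\ldots,\mathcal P_k)\mapsto\nabla(\mathcal P_1,\mathcal P_2,\ldots,\mathcal P_k)$ is a bijection from the set of $k$-multichains $\mathcal P_1\leq\cdots\leq\mathcal P_k$ in $NC(n)$ to the set of $k$-divisible noncrossing partitions of $[kn]$.
   Context: A partition of $[n]=\{1,\ldots,n\}$ is noncrossing if there are no $a<b<c<d$ with $a,c$ in one block and $b,d$ in a different block. $NC(n)$ is the lattice of noncrossing partitions of $[n]$ under refinement. A partition is $k$-divisible if every block has cardinality divisible by $k$. Kreweras complement: for $\mathcal P\in NC(n)$, $K(\mathcal P)$ is the coarsest partition $\mathcal Q$ of $[n]$ such that the partition $(2\mathcal P-1)\cup(2\mathcal Q)$ of $[2n]$ is noncrossing (translations and dilations are applied elementwise to blocks). $K$ is a bijection (an anti-automorphism) of $NC(n)$. For a finite set $X$ of integers, $K_X$ is the Kreweras complement on noncrossing partitions of $X$, transported along the order-preserving bijection $X\leftrightarrow[|X|]$. For $\mathcal P\leq\mathcal N=\{N_1,\ldots,N_t\}$ in $NC(n)$, $K^{\mathcal N}(\mathcal P)=\bigcup_{i=1}^tK_{N_i}(\mathcal P|_{N_i})$. Shuffle: for partitions $\mathcal Q_1,\ldots,\mathcal Q_k$ of $[n]$, $\langle\mathcal Q_1,\ldots,\mathcal Q_k\rangle=\bigcup_{i=1}^k(k\mathcal Q_i-(k-i))$, a partition of $[kn]$. For a $k$-multichain $\mathcal P_1\leq\cdots\leq\mathcal P_k$ in $NC(n)$,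 $$\nabla(\mathcal P_1,\ldots,\mathcal P_k)=K^{-1}\big\langle K^{\mathcal P_2}(\mathcal P_1),\ldots,K^{\mathcal P_k}(\mathcal P_{k-1}),K(\mathcal P_k)\big\rangle,$$ where the outer $K^{-1}$ is the inverse of the Kreweras complement on $NC(kn)$. *)

theory Defs
  imports "HOL-Library.Disjoint_Sets" "HOL-Library.FuncSet"
begin

definition noncrossing :: "nat set set \<Rightarrow> bool" where
  "noncrossing P \<longleftrightarrow>
     (\<nexists>a b c d B C. a < b \<and> b < c \<and> c < d \<and> B \<in> P \<and> C \<in> P \<and> B \<noteq> C \<and>
        a \<in> B \<and> c \<in> B \<and> b \<in> C \<and> d \<in> C)"

text \<open>The underlying set of the lattice; its order is \<^term>\<open>refines {1..n}\<close>.\<close>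

definition NC :: "nat \<Rightarrow> nat set set set" where
  "NC n = {P. partition_on {1..n} P \<and> noncrossing P}"

definition divisible_blocks :: "nat \<Rightarrow> nat set set \<Rightarrow> bool" where
  "divisible_blocks k P \<longleftrightarrow> (\<forall>B\<in>P. k dvd card B)"

definition map_blocks :: "(nat \<Rightarrow> nat) \<Rightarrow> nat set set \<Rightarrow> nat set set" where
  "map_blocks f P = (`) f ` P"

text \<open>Subtraction on \<^typ>\<open>nat\<close> does not truncate below, as all elements are at least 1.\<close>

definition kreweras_compatible :: "nat \<Rightarrow> nat set set \<Rightarrow> nat set set \<Rightarrow> bool" where
  "kreweras_compatible n P Q \<longleftrightarrow>
     partition_on {1..n} Q \<and>
     noncrossing (map_blocks (\<lambda>x. 2 * x - 1) P \<union> map_blocks (\<lambda>x. 2 * x) Q)"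

definition kreweras :: "nat \<Rightarrow> nat set set \<Rightarrow> nat set set" where
  "kreweras n P =
     (THE Q. kreweras_compatible n P Q \<and>
             (\<forall>R. kreweras_compatible n P R \<longrightarrow> refines {1..n} R Q))"

definition kreweras_inv :: "nat \<Rightarrow> nat set set \<Rightarrow> nat set set" where
  "kreweras_inv n = inv_into (NC n) (kreweras n)"

text \<open>For finite \<open>X\<close> this is the order-preserving bijection from \<open>X\<close> to \<open>{1..card X}\<close>.\<close>

definition rank :: "nat set \<Rightarrow> nat \<Rightarrow> nat" where
  "rank X x = card {y \<in> X. y \<le> x}"

lemma strict_mono_on_rank:
  assumes "finite X"
  shows "strict_mono_on X (rank X)"
proof (rule strict_mono_onI)
  fix x y assume "x \<in> X" "y \<in> X" "x < y"
  then have "{z \<in> X. z \<le> x} \<subset> {z \<in> X. z \<le> y}"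
    by force
  then show "rank X x < rank X y"
    unfolding rank_def using assms by (intro psubset_card_mono) auto
qed

lemma bij_betw_rank:
  assumes "finite X"
  shows "bij_betw (rank X) X {1..card X}"
proof -
  have inj: "inj_on (rank X) X"
    using strict_mono_on_rank[OF assms] by (rule strict_mono_on_imp_inj_on)
  have "rank X ` X \<subseteq> {1..card X}"
  proof (clarify, simp, intro conjI)
    fix x assume "x \<in> X"
    then have "{y \<in> X. y \<le> x} \<noteq> {}" by auto
    then show "Suc 0 \<le> rank X x"
      unfolding rank_def using assms by (simp add: Suc_le_eq card_gt_0_iff)
    show "rank X x \<le> card X"
      unfolding rank_def using assms by (intro card_mono) auto
  qed
  moreover have "card (rank X ` X) = card {1..card X}"
    using inj by (simp add: card_image)
  ultimately have "rank X ` X = {1..card X}"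
    by (intro card_subset_eq) auto
  with inj show ?thesis by (simp add: bij_betw_def)
qed

definition kreweras_on :: "nat set \<Rightarrow> nat set set \<Rightarrow> nat set set" where
  "kreweras_on X P =
     map_blocks (inv_into X (rank X)) (kreweras (card X) (map_blocks (rank X) P))"

definition restrict_blocks :: "nat set set \<Rightarrow> nat set \<Rightarrow> nat set set" where
  "restrict_blocks P X = (\<inter>) X ` P - {{}}"

definition rel_kreweras :: "nat set set \<Rightarrow> nat set set \<Rightarrow> nat set set" where
  "rel_kreweras N P = (\<Union>X\<in>N. kreweras_on X (restrict_blocks P X))"

text \<open>
  Families \<open>P 1, \<dots>, P k\<close> are functions on \<open>{1..k}\<close>, taken to be \<^const>\<open>undefined\<close>
  elsewhere so that distinct functions are distinct families.
\<close>

definition shuffle :: "nat \<Rightarrow> (nat \<Rightarrow> nat set set) \<Rightarrow> nat set set" where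
  "shuffle k Q = (\<Union>i\<in>{1..k}. map_blocks (\<lambda>x. k * x - (k - i)) (Q i))"

definition multichains :: "nat \<Rightarrow> nat \<Rightarrow> (nat \<Rightarrow> nat set set) set" where
  "multichains n k =
     {P \<in> {1..k} \<rightarrow>\<^sub>E NC n. \<forall>i\<in>{1..<k}. refines {1..n} (P i) (P (Suc i))}"

definition nabla :: "nat \<Rightarrow> nat \<Rightarrow> (nat \<Rightarrow> nat set set) \<Rightarrow> nat set set" where
  "nabla n k P =
     kreweras_inv (k * n)
       (shuffle k (\<lambda>i. if i < k then rel_kreweras (P (Suc i)) (P i) else kreweras n (P k)))"

end

theory Submission
  imports Defs
begin

text \<open>
  Place the points \<open>1, \<dots>, n\<close> on a circle, and read the elements of a Kreweras complement as gaps,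
  \<open>x\<close> being the gap just after the point \<open>x\<close>. Two gaps lie in one block of \<open>K(P)\<close> exactly if the
  chord between them crosses no chord between two points of one block of \<open>P\<close>. So \<open>K\<close> is the polar of
  the relation \<^term>\<open>uncrossed\<close> between pairs of points and pairs of gaps; in particular it
  reverses the order. For noncrossing \<open>P \<le> N\<close> the relative complement has an equally simple form,
  \<open>K\<^sup>N(P) = N \<and> K(P)\<close>, because a block of \<open>N\<close> does not separate two elements of another one
  (lemma \<open>linked_rel_kreweras\<close>).

  The main step, lemma \<open>linked_iff_uncrossed\<close>, is that for noncrossing \<open>P \<le> N\<close> the pairs linked in \<open>P\<close>
  are the pairs linked in \<open>N\<close> that are uncrossed with all pairs of gaps linked in \<open>N \<and> K(P)\<close>. Hence
  \<open>P \<mapsto> N \<and> K(P)\<close> is an injective map from the finite set of noncrossing refinements of \<open>N\<close> to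
  itself, and so a bijection. With \<open>N = {[n]}\<close> this includes the bijectivity of \<open>K\<close>.

  In a shuffle the copy of a point \<open>x\<close> in the \<open>i\<close>-th part precedes its copy in the \<open>j\<close>-th part for
  \<open>i < j\<close>. Therefore \<open>\<langle>Q\<^sub>1, \<dots>, Q\<^sub>k\<rangle>\<close> is noncrossing iff every \<open>Q\<^sub>i\<close> is and
  \<open>Q\<^sub>j \<le> K(Q\<^sub>i)\<close> for \<open>i < j\<close> (lemma \<open>noncrossing_shuffle_iff\<close>). A multichain, prolonged by
  \<open>P\<^sub>k\<^sub>+\<^sub>1 = {[n]}\<close>, is sent to \<open>Q\<^sub>i = P\<^sub>i\<^sub>+\<^sub>1 \<and> K(P\<^sub>i)\<close>, and then
  \<open>Q\<^sub>j \<le> K(P\<^sub>j) \<le> K(P\<^sub>i\<^sub>+\<^sub>1) \<le> K(Q\<^sub>i)\<close>. Conversely, given such \<open>Q\<close>, the \<open>P\<^sub>i\<close> are determined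
  one after the other from \<open>i = k\<close> down to \<open>1\<close>, by the bijection for \<open>N = P\<^sub>i\<^sub>+\<^sub>1\<close>.

  So the noncrossing shuffles that arise are all the noncrossing partitions of \<open>[kn]\<close> whose blocks
  lie in residue classes modulo \<open>k\<close>. These are the complements of the \<open>k\<close>-divisible
  partitions (lemma \<open>divisible_blocks_iff_kreweras\<close>): linked gaps enclose a union of blocks, and
  the gaps left by consecutive elements of a block are linked.
\<close>

section \<open>Partitions as equivalence relations\<close>

definition linked :: "nat set set \<Rightarrow> nat \<Rightarrow> nat \<Rightarrow> bool" where
  "linked P a b \<longleftrightarrow> (\<exists>B\<in>P. a \<in> B \<and> b \<in> B)"

text \<open>The relation is cut down to \<open>[n]\<close>, so that it may be given by a formula in arbitrary numbers.\<close>

definition classes :: "nat \<Rightarrow> (nat \<Rightarrow> nat \<Rightarrow> bool) \<Rightarrow> nat set set" where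
  "classes n R = {1..n} // {(x, y). x \<in> {1..n} \<and> y \<in> {1..n} \<and> R x y}"

lemma linkedI: "B \<in> P \<Longrightarrow> a \<in> B \<Longrightarrow> b \<in> B \<Longrightarrow> linked P a b"
  unfolding linked_def by blast

lemma linked_sym: "linked P a b \<Longrightarrow> linked P b a"
  unfolding linked_def by blast

lemma linked_refl_iff: "partition_on A P \<Longrightarrow> linked P a a \<longleftrightarrow> a \<in> A"
  unfolding linked_def partition_on_def by blast

lemma linked_in: "partition_on A P \<Longrightarrow> linked P a b \<Longrightarrow> a \<in> A \<and> b \<in> A"
  unfolding linked_def partition_on_def by blast

lemma linked_block:
  assumes "partition_on A P" "B \<in> P" "a \<in> B"
  shows "linked P a b \<longleftrightarrow> b \<in> B"
  using assms partition_onD2[OF assms(1)] unfolding linked_def disjoint_def by blast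

lemma linked_trans:
  assumes "partition_on A P" "linked P a b" "linked P b c"
  shows "linked P a c"
  using assms linked_block unfolding linked_def by metis

lemma partition_on_linked_inject:
  assumes "partition_on A P" "partition_on A Q" "\<And>a b. linked P a b \<longleftrightarrow> linked Q a b"
  shows "P = Q"
proof -
  have quotient: "A // {(x, y). linked R x y} = R" if "partition_on A R" for R
    using partition_on_eq_quotient[OF that] unfolding linked_def .
  have "{(x, y). linked P x y} = {(x, y). linked Q x y}"
    using assms(3) by blast
  then have "A // {(x, y). linked P x y} = A // {(x, y). linked Q x y}"
    by (rule arg_cong)
  then show ?thesis
    unfolding quotient[OF assms(1)] quotient[OF assms(2)] .
qed

lemma refines_iff_linked:
  assumes "partition_on A P" "partition_on A Q"
  shows "refines A P Q \<longleftrightarrow> (\<forall>a b. linked P a b \<longrightarrow> linked Q a b)"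
proof
  assume "refines A P Q"
  then show "\<forall>a b. linked P a b \<longrightarrow> linked Q a b"
    unfolding refines_def linked_def by blast
next
  assume *: "\<forall>a b. linked P a b \<longrightarrow> linked Q a b"
  have "\<exists>Y\<in>Q. X \<subseteq> Y" if X: "X \<in> P" for X
  proof -
    obtain a where a: "a \<in> X"
      using \<open>X \<in> P\<close> partition_onD3[OF assms(1)] by fastforce
    then obtain Y where "Y \<in> Q" "a \<in> Y"
      using * linkedI[OF X a a] unfolding linked_def by blast
    then have "X \<subseteq> Y"
      using * linkedI[OF X a] linked_block[OF assms(2)] by blast
    with \<open>Y \<in> Q\<close> show ?thesis by blast
  qed
  then show "refines A P Q"
    using assms unfolding refines_def by blast
qed

lemma classes:
  assumes refl: "\<And>x. x \<in> {1..n} \<Longrightarrow> R x x" and sym: "\<And>x y. R x y \<Longrightarrow> R y x"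
    and trans: "\<And>x y z. R x y \<Longrightarrow> R y z \<Longrightarrow> R x z"
  shows partition_on_classes: "partition_on {1..n} (classes n R)"
    and linked_classes: "linked (classes n R) x y \<longleftrightarrow> x \<in> {1..n} \<and> y \<in> {1..n} \<and> R x y"
proof -
  let ?r = "{(x, y). x \<in> {1..n} \<and> y \<in> {1..n} \<and> R x y}"
  have eq: "equiv {1..n} ?r"
    by (rule equivI) (auto simp: refl_on_def sym_def trans_def refl intro: sym trans)
  then show part: "partition_on {1..n} (classes n R)"
    unfolding classes_def by (rule partition_on_quotient)
  have "linked (classes n R) x y \<longleftrightarrow> (x, y) \<in> ?r"
  proof
    assume "linked (classes n R) x y"
    then show "(x, y) \<in> ?r"
      using quotient_eq_iff[OF eq] unfolding linked_def classes_def by fast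
  next
    assume xy: "(x, y) \<in> ?r"
    then have "?r `` {x} \<in> classes n R"
      unfolding classes_def by (intro quotientI) simp
    then show "linked (classes n R) x y"
      using xy refl by (auto intro!: linkedI)
  qed
  then show "linked (classes n R) x y \<longleftrightarrow> x \<in> {1..n} \<and> y \<in> {1..n} \<and> R x y"
    by simp
qed

lemma linked_map_blocks:
  "linked (map_blocks f P) u v \<longleftrightarrow> (\<exists>a b. u = f a \<and> v = f b \<and> linked P a b)"
  unfolding linked_def map_blocks_def by blast

lemma linked_restrict_blocks:
  "linked (restrict_blocks P X) a b \<longleftrightarrow> a \<in> X \<and> b \<in> X \<and> linked P a b"
  unfolding linked_def restrict_blocks_def by blast

lemma NC_partition_on: "P \<in> NC n \<Longrightarrow> partition_on {1..n} P"
  and NC_noncrossing: "P \<in> NC n \<Longrightarrow> noncrossing P"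
  unfolding NC_def by simp_all

lemma finite_NC: "finite (NC n)"
  by (rule finite_subset[OF _ finitely_many_partition_on[of "{1..n}"]]) (auto simp: NC_def)

section \<open>Crossing as a relation between points and gaps\<close>

text \<open>Points \<open>a\<close>, \<open>b\<close> against gaps \<open>x\<close>, \<open>y\<close>, the gap \<open>x\<close> lying between \<open>x\<close> and \<open>x + 1\<close>: the pair of
gaps must not separate \<open>a\<close> from \<open>b\<close> on the circle. As a parity condition on four comparisons, this
needs no case distinction on the order of the points and is an equivalence relation in \<open>a, b\<close> as
well as in \<open>x, y\<close>.\<close>

definition uncrossed :: "nat \<Rightarrow> nat \<Rightarrow> nat \<Rightarrow> nat \<Rightarrow> bool" where
  "uncrossed a b x y \<longleftrightarrow> ((a \<le> x \<longleftrightarrow> a \<le> y) \<longleftrightarrow> (b \<le> x \<longleftrightarrow> b \<le> y))"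

definition uncut :: "nat set set \<Rightarrow> nat \<Rightarrow> nat \<Rightarrow> bool" where
  "uncut P x y \<longleftrightarrow> (\<forall>a b. linked P a b \<longrightarrow> uncrossed a b x y)"

lemma uncut_refl: "uncut P x x"
  unfolding uncut_def uncrossed_def by simp

lemma uncrossed_sym: "uncrossed a b x y \<Longrightarrow> uncrossed a b y x"
  unfolding uncrossed_def by argo

lemma uncrossed_trans: "uncrossed a b x y \<Longrightarrow> uncrossed a b y z \<Longrightarrow> uncrossed a b x z"
  unfolding uncrossed_def by argo

lemma uncut_sym: "uncut P x y \<Longrightarrow> uncut P y x"
  unfolding uncut_def using uncrossed_sym by blast

lemma uncut_trans: "uncut P x y \<Longrightarrow> uncut P y z \<Longrightarrow> uncut P x z"
  unfolding uncut_def using uncrossed_trans by blast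

lemma noncrossing_linkedD:
  assumes "partition_on A P" "noncrossing P" "a < b" "b < c" "c < d" "linked P a c" "linked P b d"
  shows "linked P a b"
proof -
  obtain B C where "B \<in> P" "a \<in> B" "c \<in> B" "C \<in> P" "b \<in> C" "d \<in> C"
    using assms(6,7) unfolding linked_def by blast
  moreover from this have "B = C"
    using assms(2-5) unfolding noncrossing_def by blast
  ultimately show ?thesis by (auto intro: linkedI)
qed

lemma noncrossingI:
  assumes P: "partition_on A P"
    and link: "\<And>a b c d. a < b \<Longrightarrow> b < c \<Longrightarrow> c < d \<Longrightarrow> linked P a c \<Longrightarrow> linked P b d \<Longrightarrow> linked P a b"
  shows "noncrossing P"
  unfolding noncrossing_def
proof (rule notI, elim exE conjE)
  fix a b c d B C
  assume *: "a < b" "b < c" "c < d" "B \<in> P" "C \<in> P" "B \<noteq> C" "a \<in> B" "c \<in> B" "b \<in> C" "d \<in> C"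
  then have "b \<in> B"
    using link[OF *(1-3)] linkedI linked_block[OF P *(4,7)] by blast
  then show False
    using * partition_onD2[OF P] unfolding disjoint_def by blast
qed

text \<open>For elements of different blocks there are no equalities, so that a gap behaves like the point
before it.\<close>

lemma noncrossing_iff_uncrossed:
  assumes "partition_on A P"
  shows "noncrossing P \<longleftrightarrow>
    (\<forall>a b x y. linked P a b \<longrightarrow> linked P x y \<longrightarrow> \<not> linked P a x \<longrightarrow> uncrossed a b x y)"
    (is "_ \<longleftrightarrow> ?R")
proof
  assume nc: "noncrossing P"
  show ?R
  proof (intro allI impI)
    fix a b x y assume ab: "linked P a b" and xy: "linked P x y" and ax: "\<not> linked P a x"
    have no: "\<not> linked P u v" "\<not> linked P v u" if "u \<in> {a, b}" "v \<in> {x, y}" for u v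
      using that ab xy ax linked_sym linked_trans[OF assms] by blast+
    then have neq: "a \<noteq> x" "a \<noteq> y" "b \<noteq> x" "b \<noteq> y"
      using linked_refl_iff[OF assms] linked_in[OF assms ab] by blast+
    have c: "\<not> (u < v \<and> v < u' \<and> u' < v')" "\<not> (v < u \<and> u < v' \<and> v' < u')"
      if "linked P u u'" "linked P v v'" "\<not> linked P u v" for u u' v v'
      using that noncrossing_linkedD[OF assms nc, of u v u' v']
        noncrossing_linkedD[OF assms nc, of v u v' u'] linked_sym[of P v u] by auto
    have no': "\<not> linked P a x" "\<not> linked P a y" "\<not> linked P b x" "\<not> linked P b y"
      using no by simp_all
    note cs = c[OF ab xy no'(1)] c[OF linked_sym[OF ab] xy no'(3)]
      c[OF ab linked_sym[OF xy] no'(2)] c[OF linked_sym[OF ab] linked_sym[OF xy] no'(4)]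
    have "\<not> (a \<le> x \<and> x < b \<and> b \<le> y)" "\<not> (x < a \<and> a \<le> y \<and> y < b)"
      "\<not> (b \<le> x \<and> x < a \<and> a \<le> y)" "\<not> (x < b \<and> b \<le> y \<and> y < a)"
      "\<not> (a \<le> y \<and> y < b \<and> b \<le> x)" "\<not> (y < a \<and> a \<le> x \<and> x < b)"
      "\<not> (b \<le> y \<and> y < a \<and> a \<le> x)" "\<not> (y < b \<and> b \<le> x \<and> x < a)"
      using cs neq unfolding le_less by blast+
    then show "uncrossed a b x y"
      unfolding uncrossed_def not_le[symmetric] by argo
  qed
next
  assume R: ?R
  show "noncrossing P"
  proof (rule noncrossingI[OF assms])
    fix a b c d
    assume *: "a < b" "b < c" "c < d" "linked P a c" "linked P b d"
    then have "\<not> uncrossed a c b d"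
      unfolding uncrossed_def by linarith
    then show "linked P a b" using R * by blast
  qed
qed

section \<open>Shuffles\<close>

text \<open>The position of the point \<open>x\<close> of the \<open>i\<close>-th partition in a shuffle. By \<open>slot_le_iff\<close>, positions are
ordered lexicographically, first by \<open>x\<close> and then by \<open>i\<close>.\<close>

definition slot :: "nat \<Rightarrow> nat \<Rightarrow> nat \<Rightarrow> nat" where
  "slot k i x = k * x - (k - i)"

lemma slot_eq:
  assumes "i \<le> k" "1 \<le> x"
  shows "slot k i x = k * (x - 1) + i"
proof -
  obtain z where "x = Suc z" using assms by (cases x) auto
  then show ?thesis using assms unfolding slot_def by simp
qed

lemma slot_le_iff:
  assumes "i \<in> {1..k}" "j \<in> {1..k}" "1 \<le> a" "1 \<le> b"
  shows "slot k i a \<le> slot k j b \<longleftrightarrow> a < b \<or> a = b \<and> i \<le> j"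
proof -
  obtain a' b' where ab: "a = Suc a'" "b = Suc b'" using assms by (cases a; cases b) auto
  have less: "k * c + p < k * d + q" if "c < d" "p \<le> k" "1 \<le> q" for c d p q :: nat
  proof -
    have "k * Suc c \<le> k * d" using that by (intro mult_le_mono) auto
    then show ?thesis using that by simp
  qed
  show ?thesis
    using less[of a' b' i j] less[of b' a' j i] assms
    by (cases a' b' rule: linorder_cases) (auto simp: slot_eq ab)
qed

lemma slot_inject:
  assumes "i \<in> {1..k}" "j \<in> {1..k}" "1 \<le> a" "1 \<le> b"
  shows "slot k i a = slot k j b \<longleftrightarrow> i = j \<and> a = b"
  unfolding order.eq_iff[of "slot k i a"] slot_le_iff[OF assms] slot_le_iff[OF assms(2,1,4,3)]
  by auto

lemma slot_mem:
  assumes "i \<in> {1..k}" "a \<in> {1..n}"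
  shows "slot k i a \<in> {1..k * n}"
proof -
  have "k * a \<le> k * n" using assms by (intro mult_le_mono) auto
  moreover have "k * 1 \<le> k * a" using assms by (intro mult_le_mono) auto
  ultimately show ?thesis using assms unfolding slot_def atLeastAtMost_iff by linarith
qed

lemma slot_exists:
  assumes "u \<in> {1..k * n}"
  obtains i a where "i \<in> {1..k}" "a \<in> {1..n}" "u = slot k i a"
proof
  have k: "k > 0" using assms by (cases k) auto
  show "(u - 1) mod k + 1 \<in> {1..k}" using k by (simp add: Suc_leI)
  have "u - 1 < n * k" using assms by (simp add: mult.commute) linarith
  then have "(u - 1) div k < n" by (rule less_mult_imp_div_less)
  then show "(u - 1) div k + 1 \<in> {1..n}" by simp
  have "u = k * ((u - 1) div k) + (u - 1) mod k + 1" using assms by simp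
  also have "\<dots> = slot k ((u - 1) mod k + 1) ((u - 1) div k + 1)"
    using k by (subst slot_eq) (auto simp: Suc_leI)
  finally show "u = slot k ((u - 1) mod k + 1) ((u - 1) div k + 1)" .
qed

lemma slot_mod_eq_iff:
  assumes "i \<in> {1..k}" "j \<in> {1..k}" "1 \<le> a" "1 \<le> b"
  shows "slot k i a mod k = slot k j b mod k \<longleftrightarrow> i = j"
proof -
  have "slot k i a mod k = i mod k" "slot k j b mod k = j mod k"
    using assms by (simp_all add: slot_eq)
  moreover have "i mod k = j mod k \<longleftrightarrow> i = j"
    using assms by (cases "i = k"; cases "j = k") auto
  ultimately show ?thesis by simp
qed

lemma linked_shuffle:
  "linked (shuffle k Q) u v \<longleftrightarrow>
    (\<exists>i\<in>{1..k}. \<exists>a b. u = slot k i a \<and> v = slot k i b \<and> linked (Q i) a b)"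
proof -
  have "linked (shuffle k Q) u v \<longleftrightarrow>
      (\<exists>i\<in>{1..k}. linked (map_blocks (\<lambda>x. k * x - (k - i)) (Q i)) u v)"
    unfolding shuffle_def linked_def by blast
  then show ?thesis
    unfolding linked_map_blocks slot_def by blast
qed

lemma linked_shuffle_slot:
  assumes "\<forall>i\<in>{1..k}. partition_on {1..n} (Q i)" "i \<in> {1..k}" "j \<in> {1..k}" "a \<in> {1..n}" "b \<in> {1..n}"
  shows "linked (shuffle k Q) (slot k i a) (slot k j b) \<longleftrightarrow> i = j \<and> linked (Q i) a b"
proof
  assume "linked (shuffle k Q) (slot k i a) (slot k j b)"
  then obtain l c d where l: "l \<in> {1..k}" "slot k i a = slot k l c" "slot k j b = slot k l d"
    "linked (Q l) c d"
    unfolding linked_shuffle by blast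
  moreover from this have "c \<in> {1..n}" "d \<in> {1..n}"
    using assms(1) linked_in by blast+
  ultimately have "i = l \<and> a = c" "j = l \<and> b = d"
    using slot_inject[of i k l a c] slot_inject[of j k l b d] assms by auto
  then show "i = j \<and> linked (Q i) a b" using l by blast
next
  assume "i = j \<and> linked (Q i) a b"
  then show "linked (shuffle k Q) (slot k i a) (slot k j b)"
    using assms(2) unfolding linked_shuffle by blast
qed

lemma partition_on_shuffle:
  assumes Q: "\<forall>i\<in>{1..k}. partition_on {1..n} (Q i)"
  shows "partition_on {1..k * n} (shuffle k Q)"
proof (rule partition_onI)
  have mem: "B \<in> shuffle k Q \<longleftrightarrow> (\<exists>i\<in>{1..k}. \<exists>C\<in>Q i. B = slot k i ` C)" for B
    unfolding shuffle_def map_blocks_def slot_def by blast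
  have sub: "C \<subseteq> {1..n}" if "i \<in> {1..k}" "C \<in> Q i" for i C
    using Q that partition_onD1 by blast
  show "{} \<notin> shuffle k Q"
    using Q partition_onD3 unfolding mem by blast
  show "\<Union>(shuffle k Q) = {1..k * n}"
  proof (intro equalityI subsetI)
    fix u assume "u \<in> \<Union>(shuffle k Q)"
    then obtain i C a where "i \<in> {1..k}" "C \<in> Q i" "a \<in> C" "u = slot k i a"
      unfolding Union_iff using mem by blast
    then show "u \<in> {1..k * n}" using sub slot_mem by blast
  next
    fix u assume "u \<in> {1..k * n}"
    then obtain i a where ia: "i \<in> {1..k}" "a \<in> {1..n}" "u = slot k i a" by (rule slot_exists)
    then have "linked (shuffle k Q) u u"
      using linked_shuffle_slot[OF Q] linked_refl_iff Q by blast
    then show "u \<in> \<Union>(shuffle k Q)" unfolding linked_def by blast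
  qed
  fix p q assume p: "p \<in> shuffle k Q" and q: "q \<in> shuffle k Q" and neq: "p \<noteq> q"
  obtain i C where i: "i \<in> {1..k}" "C \<in> Q i" "p = slot k i ` C" using p unfolding mem by blast
  obtain j D where j: "j \<in> {1..k}" "D \<in> Q j" "q = slot k j ` D" using q unfolding mem by blast
  have False if "u \<in> p" "u \<in> q" for u
  proof -
    obtain c d where cd: "c \<in> C" "d \<in> D" "u = slot k i c" "u = slot k j d"
      using \<open>u \<in> p\<close> \<open>u \<in> q\<close> i(3) j(3) by auto
    then have "i = j \<and> c = d"
      using slot_inject[OF i(1) j(1), of c d] subsetD[OF sub[OF i(1,2)] cd(1)]
        subsetD[OF sub[OF j(1,2)] cd(2)] by simp
    then have "C = D"
      using cd i j Q partition_onD2 unfolding disjoint_def by blast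
    then show False using neq i j \<open>i = j \<and> c = d\<close> by simp
  qed
  then show "disjnt p q" unfolding disjnt_def by blast
qed

text \<open>For \<open>i < j\<close> the \<open>j\<close>-copy of \<open>x\<close> lies between the \<open>i\<close>-copies of \<open>x\<close> and \<open>x + 1\<close>, so that it is the gap
\<open>x\<close> from the viewpoint of the \<open>i\<close>-th partition. In the second claim all four comparisons are
negated, which does not change the parity.\<close>

lemma uncrossed_slot:
  assumes "i \<in> {1..k}" "j \<in> {1..k}" "i < j" "1 \<le> a" "1 \<le> b" "1 \<le> x" "1 \<le> y"
  shows "uncrossed (slot k i a) (slot k i b) (slot k j x) (slot k j y) \<longleftrightarrow> uncrossed a b x y"
    and "uncrossed (slot k j x) (slot k j y) (slot k i a) (slot k i b) \<longleftrightarrow> uncrossed a b x y"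
proof -
  have "slot k i p \<le> slot k j q \<longleftrightarrow> p \<le> q" if "1 \<le> p" "1 \<le> q" for p q
    using that assms(1-3) by (auto simp: slot_le_iff)
  then show "uncrossed (slot k i a) (slot k i b) (slot k j x) (slot k j y) \<longleftrightarrow> uncrossed a b x y"
    using assms(4-7) unfolding uncrossed_def by simp
  have "slot k j q \<le> slot k i p \<longleftrightarrow> \<not> p \<le> q" if "1 \<le> p" "1 \<le> q" for p q
    using that assms(1-3) by (auto simp: slot_le_iff)
  then show "uncrossed (slot k j x) (slot k j y) (slot k i a) (slot k i b) \<longleftrightarrow> uncrossed a b x y"
    using assms(4-7) unfolding uncrossed_def by simp argo
qed

text \<open>Crossing is a condition on pairs of blocks. Two blocks of one part are compared inside that part,
and two blocks of different parts by lemma \<open>uncrossed_slot\<close>.\<close>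

lemma noncrossing_shuffle_iff:
  assumes Q: "\<forall>i\<in>{1..k}. partition_on {1..n} (Q i)"
  shows "noncrossing (shuffle k Q) \<longleftrightarrow>
    (\<forall>i\<in>{1..k}. noncrossing (Q i)) \<and>
    (\<forall>i\<in>{1..k}. \<forall>j\<in>{1..k}. i < j \<longrightarrow> (\<forall>x y. linked (Q j) x y \<longrightarrow> uncut (Q i) x y))"
    (is "?L \<longleftrightarrow> ?A \<and> ?B")
proof -
  note nc = noncrossing_iff_uncrossed[OF partition_on_shuffle[OF Q]]
  have ge: "1 \<le> a" "1 \<le> b" "a \<in> {1..n}" "b \<in> {1..n}" if "i \<in> {1..k}" "linked (Q i) a b" for i a b
    using linked_in[OF _ that(2)] Q that(1) by fastforce+
  have same: "uncrossed (slot k i a) (slot k i b) (slot k i x) (slot k i y) \<longleftrightarrow> uncrossed a b x y"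
    if "i \<in> {1..k}" "linked (Q i) a b" "linked (Q i) x y" for i a b x y
  proof -
    have "slot k i p \<le> slot k i q \<longleftrightarrow> p \<le> q" if "1 \<le> p" "1 \<le> q" for p q
      using that \<open>i \<in> {1..k}\<close> by (auto simp: slot_le_iff)
    then show ?thesis
      using ge(1,2)[OF that(1,2)] ge(1,2)[OF that(1,3)] unfolding uncrossed_def by simp
  qed
  show ?thesis
  proof (intro iffI conjI)
    assume L: ?L
    show ?A
    proof
      fix i assume i: "i \<in> {1..k}"
      show "noncrossing (Q i)"
        unfolding noncrossing_iff_uncrossed[OF Q[rule_format, OF i]]
      proof (intro allI impI)
        fix a b x y assume *: "linked (Q i) a b" "linked (Q i) x y" "\<not> linked (Q i) a x"
        note g = ge[OF i *(1)] ge[OF i *(2)]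
        have "uncrossed (slot k i a) (slot k i b) (slot k i x) (slot k i y)"
          using L[unfolded nc] *
          by (simp add: linked_shuffle_slot[OF Q i i g(3,4)] linked_shuffle_slot[OF Q i i g(7,8)]
            linked_shuffle_slot[OF Q i i g(3,7)])
        then show "uncrossed a b x y" unfolding same[OF i *(1,2)] .
      qed
    qed
    show ?B
      unfolding uncut_def
    proof (intro ballI impI allI)
      fix i j x y a b
      assume i: "i \<in> {1..k}" and j: "j \<in> {1..k}" and *: "i < j" "linked (Q j) x y" "linked (Q i) a b"
      note g = ge[OF i *(3)] ge[OF j *(2)]
      have "uncrossed (slot k i a) (slot k i b) (slot k j x) (slot k j y)"
        using L[unfolded nc] *
        by (simp add: linked_shuffle_slot[OF Q i i g(3,4)] linked_shuffle_slot[OF Q j j g(7,8)]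
          linked_shuffle_slot[OF Q i j g(3,7)])
      then show "uncrossed a b x y"
        unfolding uncrossed_slot(1)[OF i j *(1) g(1,2,5,6)] .
    qed
  next
    assume AB: "?A \<and> ?B"
    show ?L
      unfolding nc
    proof (intro allI impI)
      fix u v w z
      assume uv: "linked (shuffle k Q) u v" and wz: "linked (shuffle k Q) w z"
        and no: "\<not> linked (shuffle k Q) u w"
      obtain i a b where i: "i \<in> {1..k}" "u = slot k i a" "v = slot k i b" "linked (Q i) a b"
        using uv unfolding linked_shuffle by blast
      obtain j x y where j: "j \<in> {1..k}" "w = slot k j x" "z = slot k j y" "linked (Q j) x y"
        using wz unfolding linked_shuffle by blast
      note g = ge[OF i(1,4)] ge[OF j(1,4)]
      consider "i = j" | "i < j" | "j < i" by linarith
      then show "uncrossed u v w z"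
      proof cases
        case 1
        then have "\<not> linked (Q i) a x"
          using no linked_shuffle_slot[OF Q i(1) j(1) g(3,7)] unfolding i(2) j(2) by blast
        moreover have xy: "linked (Q i) x y" using j(4) 1 by simp
        ultimately have "uncrossed a b x y"
          using AB i(1,4) noncrossing_iff_uncrossed[OF Q[rule_format, OF i(1)]] by blast
        then show ?thesis
          unfolding i(2,3) j(2,3) 1[symmetric] same[OF i(1,4) xy] .
      next
        case 2
        then have "uncrossed a b x y" using AB i j unfolding uncut_def by blast
        then show ?thesis unfolding i(2,3) j(2,3) uncrossed_slot(1)[OF i(1) j(1) 2 g(1,2,5,6)] .
      next
        case 3
        then have "uncrossed x y a b" using AB i j unfolding uncut_def by blast
        then show ?thesis unfolding i(2,3) j(2,3) uncrossed_slot(2)[OF j(1) i(1) 3 g(5,6,1,2)] .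
      qed
    qed
  qed
qed

section \<open>The Kreweras complement as a relation\<close>

lemma partition_on_classes_uncut: "partition_on {1..n} (classes n (uncut P))"
  by (rule partition_on_classes) (rule uncut_refl | erule uncut_sym | erule (1) uncut_trans)+

lemma linked_classes_uncut:
  "linked (classes n (uncut P)) x y \<longleftrightarrow> x \<in> {1..n} \<and> y \<in> {1..n} \<and> uncut P x y"
  by (rule linked_classes) (rule uncut_refl | erule uncut_sym | erule (1) uncut_trans)+

text \<open>Each pair of points cuts the gaps into an interval and its complement, and two crossing pairs of
gaps cannot lie on different sides. This is why complements are noncrossing.\<close>

lemma uncut_convex:
  assumes "a < b" "b < c" "c < d" "uncut P a c" "uncut P b d"
  shows "uncut P a b"
proof -
  have "uncrossed p q a b" if "uncrossed p q a c" "uncrossed p q b d" for p q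
    using that assms(1-3) unfolding uncrossed_def by linarith
  then show ?thesis using assms(4,5) unfolding uncut_def by blast
qed

lemma noncrossing_classes_uncut: "noncrossing (classes n (uncut P))"
  using uncut_convex
  by (intro noncrossingI[OF partition_on_classes_uncut]) (auto simp: linked_classes_uncut)

text \<open>The interleaving in the definition of the complement is a shuffle with two parts, where the points
of the second are the gaps of the first.\<close>

lemma kreweras_compatible_iff:
  assumes P: "P \<in> NC n"
  shows "kreweras_compatible n P Q \<longleftrightarrow>
    partition_on {1..n} Q \<and> noncrossing Q \<and> (\<forall>x y. linked Q x y \<longrightarrow> uncut P x y)"
proof (cases "partition_on {1..n} Q")
  case True
  let ?F = "\<lambda>i::nat. if i = 1 then P else Q"
  have two: "{1..2::nat} = {1, 2}" by auto
  have "map_blocks (\<lambda>x. 2 * x - 1) P \<union> map_blocks (\<lambda>x. 2 * x) Q = shuffle 2 ?F"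
    unfolding shuffle_def two by simp
  moreover have "\<forall>i\<in>{1..2}. partition_on {1..n} (?F i)"
    using True NC_partition_on[OF P] by simp
  ultimately show ?thesis
    using True NC_noncrossing[OF P] noncrossing_shuffle_iff[of 2 n ?F]
    unfolding kreweras_compatible_def two by simp
qed (simp add: kreweras_compatible_def)

lemma kreweras_eq_classes:
  assumes P: "P \<in> NC n"
  shows "kreweras n P = classes n (uncut P)"
proof -
  note part = partition_on_classes_uncut and link = linked_classes_uncut
  have compat: "kreweras_compatible n P (classes n (uncut P))"
    unfolding kreweras_compatible_iff[OF P] using part noncrossing_classes_uncut link by blast
  have coarsest: "refines {1..n} R (classes n (uncut P))" if "kreweras_compatible n P R" for R
    using that part refines_iff_linked[of "{1..n}" R "classes n (uncut P)"] linked_in[of "{1..n}" R]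
    unfolding kreweras_compatible_iff[OF P] link by blast
  show ?thesis
    unfolding kreweras_def
    by (rule the_equality) (use compat coarsest refines_asym in blast)+
qed

lemma kreweras_in_NC: "P \<in> NC n \<Longrightarrow> kreweras n P \<in> NC n"
  unfolding kreweras_eq_classes
  unfolding NC_def by (simp add: noncrossing_classes_uncut partition_on_classes_uncut del: One_nat_def)

lemma linked_kreweras:
  "P \<in> NC n \<Longrightarrow> linked (kreweras n P) x y \<longleftrightarrow> x \<in> {1..n} \<and> y \<in> {1..n} \<and> uncut P x y"
  by (simp add: kreweras_eq_classes linked_classes_uncut)

lemma uncrossed_rank:
  assumes "finite X" "a \<in> X" "b \<in> X" "x \<in> X" "y \<in> X"
  shows "uncrossed (rank X a) (rank X b) (rank X x) (rank X y) \<longleftrightarrow> uncrossed a b x y"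
  unfolding uncrossed_def
  using assms strict_mono_on_less_eq[OF strict_mono_on_rank[OF assms(1)]] by simp

lemma partition_on_map_blocks:
  assumes P: "partition_on A P" and inj: "inj_on f A"
  shows "partition_on (f ` A) (map_blocks f P)"
proof -
  have "(`) f ` P - {{}} = (`) f ` P" using partition_onD3[OF P] by auto
  then show ?thesis
    using partition_on_inj_image[OF P inj] unfolding map_blocks_def by simp
qed

text \<open>Crossing depends on the order only, so the ranking of \<open>X\<close> drops out.\<close>

lemma kreweras_on:
  assumes X: "finite X" and P: "partition_on X P" "noncrossing P"
  shows partition_on_kreweras_on: "partition_on X (kreweras_on X P)"
    and linked_kreweras_on: "linked (kreweras_on X P) x y \<longleftrightarrow> x \<in> X \<and> y \<in> X \<and> uncut P x y"
proof -
  let ?r = "rank X" and ?P = "map_blocks (rank X) P"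
  note bij = bij_betw_rank[OF X]
  have inj: "inj_on ?r X" and img: "?r ` X = {1..card X}"
    using bij by (auto simp: bij_betw_def)
  have part: "partition_on {1..card X} ?P"
    using partition_on_map_blocks[OF P(1) inj] img by simp
  have rlink: "linked ?P (?r a) (?r b) \<longleftrightarrow> linked P a b" if "a \<in> X" "b \<in> X" for a b
    using that linked_in[OF P(1)] inj_onD[OF inj] unfolding linked_map_blocks by metis
  have rlinkE: "\<exists>a\<in>X. \<exists>b\<in>X. u = ?r a \<and> v = ?r b \<and> linked P a b" if "linked ?P u v" for u v
    using that linked_in[OF P(1)] unfolding linked_map_blocks by blast
  have "noncrossing ?P"
    unfolding noncrossing_iff_uncrossed[OF part]
  proof (intro allI impI)
    fix u v w z assume *: "linked ?P u v" "linked ?P w z" "\<not> linked ?P u w"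
    obtain a b where ab: "a \<in> X" "b \<in> X" "u = ?r a" "v = ?r b" "linked P a b"
      using rlinkE[OF *(1)] by blast
    obtain c d where cd: "c \<in> X" "d \<in> X" "w = ?r c" "z = ?r d" "linked P c d"
      using rlinkE[OF *(2)] by blast
    have "\<not> linked P a c" using * ab cd rlink by blast
    then have "uncrossed a b c d"
      using P ab cd noncrossing_iff_uncrossed by blast
    then show "uncrossed u v w z" using uncrossed_rank[OF X] ab cd by simp
  qed
  then have NC: "?P \<in> NC (card X)" using part unfolding NC_def by simp
  have uncut: "uncut ?P (?r x) (?r y) \<longleftrightarrow> uncut P x y" if "x \<in> X" "y \<in> X" for x y
  proof
    assume *: "uncut ?P (?r x) (?r y)"
    show "uncut P x y"
      unfolding uncut_def
    proof (intro allI impI)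
      fix a b assume ab: "linked P a b"
      then have X': "a \<in> X" "b \<in> X" using linked_in[OF P(1)] by blast+
      then have "uncrossed (?r a) (?r b) (?r x) (?r y)"
        using * ab rlink unfolding uncut_def by blast
      then show "uncrossed a b x y" using uncrossed_rank[OF X X' that] by simp
    qed
  next
    assume *: "uncut P x y"
    show "uncut ?P (?r x) (?r y)"
      unfolding uncut_def
    proof (intro allI impI)
      fix u v assume "linked ?P u v"
      then obtain a b where ab: "a \<in> X" "b \<in> X" "u = ?r a" "v = ?r b" "linked P a b"
        using rlinkE by blast
      then show "uncrossed u v (?r x) (?r y)"
        using * uncrossed_rank[OF X ab(1,2) that] unfolding uncut_def by simp
    qed
  qed
  let ?s = "inv_into X ?r"
  have sinj: "inj_on ?s {1..card X}" and simg: "?s ` {1..card X} = X"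
    using bij_betw_inv_into[OF bij] by (auto simp: bij_betw_def)
  have K: "partition_on {1..card X} (kreweras (card X) ?P)"
    using kreweras_in_NC[OF NC] by (rule NC_partition_on)
  show "partition_on X (kreweras_on X P)"
    using partition_on_map_blocks[OF K sinj] simg unfolding kreweras_on_def by simp
  show "linked (kreweras_on X P) x y \<longleftrightarrow> x \<in> X \<and> y \<in> X \<and> uncut P x y"
  proof
    assume "linked (kreweras_on X P) x y"
    then obtain u v where uv: "x = ?s u" "y = ?s v" "linked (kreweras (card X) ?P) u v"
      unfolding kreweras_on_def linked_map_blocks by blast
    then have "u \<in> ?r ` X" "v \<in> ?r ` X" "uncut ?P u v"
      unfolding linked_kreweras[OF NC] img by simp_all
    moreover from this obtain a b where "a \<in> X" "b \<in> X" "u = ?r a" "v = ?r b" by blast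
    ultimately show "x \<in> X \<and> y \<in> X \<and> uncut P x y"
      using uncut uv(1,2) inj by simp
  next
    assume *: "x \<in> X \<and> y \<in> X \<and> uncut P x y"
    then have "linked (kreweras (card X) ?P) (?r x) (?r y)"
      unfolding linked_kreweras[OF NC] img[symmetric] using uncut by simp
    moreover have "x = ?s (?r x)" "y = ?s (?r y)"
      using * inj by simp_all
    ultimately show "linked (kreweras_on X P) x y"
      unfolding kreweras_on_def linked_map_blocks by blast
  qed
qed

lemma partition_on_Union_blocks:
  assumes N: "partition_on A N" and F: "\<And>X. X \<in> N \<Longrightarrow> partition_on X (F X)"
  shows "partition_on A (\<Union>X\<in>N. F X)"
proof (rule partition_onI)
  have sub: "B \<subseteq> X" if "X \<in> N" "B \<in> F X" for X B
    using partition_onD1[OF F[OF that(1)]] that(2) by blast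
  show "{} \<notin> (\<Union>X\<in>N. F X)" using F partition_onD3 by blast
  have "\<Union>(\<Union>X\<in>N. F X) = (\<Union>X\<in>N. \<Union>(F X))" by blast
  also have "\<dots> = \<Union>N" using partition_onD1[OF F] by auto
  finally show "\<Union>(\<Union>X\<in>N. F X) = A" using partition_onD1[OF N] by simp
  fix p q assume "p \<in> (\<Union>X\<in>N. F X)" "q \<in> (\<Union>X\<in>N. F X)" and neq: "p \<noteq> q"
  then obtain X Y where XY: "X \<in> N" "p \<in> F X" "Y \<in> N" "q \<in> F Y" by blast
  show "disjnt p q"
  proof (cases "X = Y")
    case True
    then show ?thesis
      using XY neq partition_onD2[OF F[OF XY(1)]] unfolding disjoint_def disjnt_def by blast
  next
    case False
    then have "X \<inter> Y = {}" using XY partition_onD2[OF N] unfolding disjoint_def by blast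
    then show ?thesis using sub XY unfolding disjnt_def by blast
  qed
qed

text \<open>This is \<open>K\<^sup>N(P) = N \<and> K(P)\<close>. The complement within a block \<open>X\<close> of \<open>N\<close> tests only the links of \<open>P\<close>
inside \<open>X\<close>. A link outside \<open>X\<close> lies in another block of \<open>N\<close>, and as \<open>N\<close> is noncrossing it crosses no
pair in \<open>X\<close> anyway.\<close>

lemma rel_kreweras:
  assumes N: "N \<in> NC n" and P: "P \<in> NC n" and ref: "refines {1..n} P N"
  shows partition_on_rel_kreweras: "partition_on {1..n} (rel_kreweras N P)"
    and linked_rel_kreweras: "linked (rel_kreweras N P) x y \<longleftrightarrow> linked N x y \<and> uncut P x y"
proof -
  note pN = NC_partition_on[OF N] and pP = NC_partition_on[OF P]
  have le: "linked N a b" if "linked P a b" for a b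
    using that ref refines_iff_linked[OF pP pN] by blast
  have sub: "X \<subseteq> {1..n}" if "X \<in> N" for X using that pN partition_onD1 by blast
  have fin: "finite X" if "X \<in> N" for X using sub[OF that] by (rule finite_subset) simp
  have part: "partition_on X (restrict_blocks P X)" if "X \<in> N" for X
    using partition_on_restrict[OF pP, of X] sub[OF that]
    unfolding restrict_blocks_def by (simp add: Int_absorb2)
  have nc: "noncrossing (restrict_blocks P X)" if "X \<in> N" for X
    using NC_noncrossing[OF P]
    unfolding noncrossing_iff_uncrossed[OF part[OF that]] noncrossing_iff_uncrossed[OF pP]
      linked_restrict_blocks by blast
  have uncut: "uncut (restrict_blocks P X) x y \<longleftrightarrow> uncut P x y" if "X \<in> N" "x \<in> X" "y \<in> X" for X x y
  proof
    assume *: "uncut (restrict_blocks P X) x y"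
    show "uncut P x y"
      unfolding uncut_def
    proof (intro allI impI)
      fix a b assume ab: "linked P a b"
      show "uncrossed a b x y"
      proof (cases "a \<in> X")
        case True
        then have "b \<in> X" using linked_block[OF pN that(1)] le[OF ab] by blast
        then show ?thesis using * ab True unfolding uncut_def linked_restrict_blocks by blast
      next
        case False
        then have "\<not> linked N a x" using linked_block[OF pN that(1,2)] linked_sym by blast
        then show ?thesis
          using NC_noncrossing[OF N] le[OF ab] linkedI[OF that]
          unfolding noncrossing_iff_uncrossed[OF pN] by blast
      qed
    qed
  qed (auto simp: uncut_def linked_restrict_blocks)
  show "partition_on {1..n} (rel_kreweras N P)"
    unfolding rel_kreweras_def
    by (rule partition_on_Union_blocks[OF pN partition_on_kreweras_on[OF fin part nc]])
  have "linked (rel_kreweras N P) x y \<longleftrightarrow>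
      (\<exists>X\<in>N. linked (kreweras_on X (restrict_blocks P X)) x y)"
    unfolding rel_kreweras_def linked_def by blast
  also have "\<dots> \<longleftrightarrow> (\<exists>X\<in>N. x \<in> X \<and> y \<in> X \<and> uncut P x y)"
  proof (rule bex_cong[OF refl])
    fix X assume "X \<in> N"
    then show "linked (kreweras_on X (restrict_blocks P X)) x y \<longleftrightarrow> x \<in> X \<and> y \<in> X \<and> uncut P x y"
      using linked_kreweras_on[OF fin part nc] uncut by blast
  qed
  also have "\<dots> \<longleftrightarrow> linked N x y \<and> uncut P x y"
    unfolding linked_def by blast
  finally show "linked (rel_kreweras N P) x y \<longleftrightarrow> linked N x y \<and> uncut P x y" .
qed

section \<open>Recovering a partition from its relative complement\<close>

text \<open>Between consecutive elements \<open>c < d\<close> of a block only whole blocks fit; so the gap after \<open>c\<close> and the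
gap before \<open>d\<close> are linked in the complement.\<close>

lemma uncut_consecutive:
  assumes P: "partition_on A P" "noncrossing P" and B: "B \<in> P" "c \<in> B" "d \<in> B"
    and cd: "c < d" "\<And>e. e \<in> B \<Longrightarrow> e \<le> c \<or> d \<le> e"
  shows "uncut P c (d - 1)"
  unfolding uncut_def
proof (intro allI impI)
  fix a b assume ab: "linked P a b"
  show "uncrossed a b c (d - 1)"
  proof (cases "a \<in> B")
    case True
    then have "b \<in> B" using ab linked_block[OF P(1) B(1)] by blast
    then show ?thesis
      using cd(1) cd(2)[OF True] cd(2)[OF \<open>b \<in> B\<close>] unfolding uncrossed_def by auto
  next
    case False
    then have "\<not> linked P a c" "b \<noteq> d" "a \<noteq> d"
      using ab B linked_block[OF P(1)] linked_sym by blast+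
    moreover from this have "uncrossed a b c d"
      using P ab linkedI[OF B] noncrossing_iff_uncrossed by blast
    ultimately show ?thesis using cd(1) unfolding uncrossed_def by auto
  qed
qed

text \<open>The cyclic counterpart of \<open>uncut_consecutive\<close>, for the last and the first element of a block. The gap
before the first element may be \<open>0\<close>, which for points \<open>1, \<dots>, n\<close> on a circle is the same gap as \<open>n\<close>.\<close>

lemma uncut_outer:
  assumes P: "partition_on A P" "noncrossing P" and "0 \<notin> A" and B: "B \<in> P" "c \<in> B" "d \<in> B"
    and cd: "\<And>e. e \<in> B \<Longrightarrow> c \<le> e \<and> e \<le> d"
  shows "uncut P (c - 1) d"
  unfolding uncut_def
proof (intro allI impI)
  have "c \<in> A" using B partition_onD1[OF P(1)] by blast
  then have "c > 0" using \<open>0 \<notin> A\<close> by (cases c) auto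
  fix a b assume ab: "linked P a b"
  show "uncrossed a b (c - 1) d"
  proof (cases "a \<in> B")
    case True
    then have "b \<in> B" using ab linked_block[OF P(1) B(1)] by blast
    then show ?thesis
      using \<open>c > 0\<close> cd[OF True] cd[OF \<open>b \<in> B\<close>] unfolding uncrossed_def by auto
  next
    case False
    then have "\<not> linked P a c" "b \<noteq> c" "a \<noteq> c"
      using ab B linked_block[OF P(1)] linked_sym by blast+
    moreover from this have "uncrossed a b c d"
      using P ab linkedI[OF B] noncrossing_iff_uncrossed by blast
    ultimately show ?thesis using \<open>c > 0\<close> unfolding uncrossed_def by (auto simp: le_less)
  qed
qed

lemma uncut_mono: "\<forall>a b. linked P a b \<longrightarrow> linked N a b \<Longrightarrow> uncut N x y \<Longrightarrow> uncut P x y"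
  unfolding uncut_def by blast

text \<open>Suppose that \<open>i < j\<close> lie in the block \<open>X\<close> of \<open>N\<close> but in different blocks of \<open>P\<close>, and let \<open>B\<close> be the
block of \<open>i\<close>. Let \<open>m\<close> be the last element of \<open>B\<close> before \<open>j\<close> and \<open>m'\<close> the element of \<open>B\<close> that follows
\<open>m\<close> cyclically. The gap after \<open>m\<close> is linked with the gap before \<open>m'\<close> in \<open>K(P)\<close>. That gap need not be
an element of \<open>X\<close>, but it is linked in \<open>K(N)\<close>, hence in \<open>K(P)\<close>, with the cyclic predecessor \<open>l\<close> of \<open>m'\<close>
in \<open>X\<close>. So \<open>m\<close> and \<open>l\<close> are linked in \<open>N \<and> K(P)\<close> and separate \<open>i\<close> from \<open>j\<close>. The three
cases of the proof are the positions of the origin: \<open>m'\<close> after \<open>j\<close>, wrapping around in \<open>B\<close> but not in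
\<open>X\<close>, and wrapping around in both.\<close>

lemma linked_if_uncrossed_less:
  assumes N: "N \<in> NC n" and P: "P \<in> NC n" and le: "\<forall>a b. linked P a b \<longrightarrow> linked N a b"
    and ij: "linked N i j" "i < j"
    and un: "\<And>x y. linked N x y \<Longrightarrow> uncut P x y \<Longrightarrow> uncrossed i j x y"
  shows "linked P i j"
proof (rule ccontr)
  assume notlinked: "\<not> linked P i j"
  note pN = NC_partition_on[OF N] and nN = NC_noncrossing[OF N]
    and pP = NC_partition_on[OF P] and nP = NC_noncrossing[OF P]
  obtain X where X: "X \<in> N" "i \<in> X" "j \<in> X" using ij unfolding linked_def by blast
  have "linked P i i" using linked_in[OF pN ij(1)] linked_refl_iff[OF pP] by blast
  then obtain B where B: "B \<in> P" "i \<in> B" unfolding linked_def by blast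
  have "j \<notin> B" using notlinked linked_block[OF pP B] by blast
  have BX: "B \<subseteq> X"
    using le linked_block[OF pP B] linked_block[OF pN X(1,2)] by blast
  have "X \<subseteq> {1..n}" using X pN partition_onD1 by blast
  then have fX: "finite X" by (rule finite_subset) simp
  have fB: "finite B" using BX fX by (rule finite_subset)
  have linkX: "linked N x y" if "x \<in> X" "y \<in> X" for x y using that X linkedI by blast
  define m where "m = Max {x\<in>B. x < j}"
  have "m \<in> {x\<in>B. x < j}" unfolding m_def using fB B ij by (intro Max_in) auto
  then have m: "m \<in> B" "m < j" by auto
  have m_max: "e \<le> m" if "e \<in> B" "e < j" for e
    unfolding m_def using that fB by (intro Max_ge) auto
  have "i \<le> m" using m_max B ij by blast
  \<comment> \<open>The gap \<open>m\<close> lies between \<open>i\<close> and \<open>j\<close>, so a gap outside \<open>{i..<j}\<close> linked with it separates them.\<close>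
  have contra: False if "l \<in> X" "l < i \<or> j \<le> l" "uncut P m l" for l
    using un[OF linkX[of m l] that(3)] that(1,2) m BX \<open>i \<le> m\<close> ij
    unfolding uncrossed_def by auto
  show False
  proof (cases "\<exists>e\<in>B. j < e")
    case True
    define m' where "m' = Min {x\<in>B. j < x}"
    have "m' \<in> {x\<in>B. j < x}" unfolding m'_def using fB True by (intro Min_in) auto
    then have m': "m' \<in> B" "j < m'" by auto
    have m'_min: "m' \<le> e" if "e \<in> B" "j < e" for e
      unfolding m'_def using that fB by (intro Min_le) auto
    define l where "l = Max {x\<in>X. x < m'}"
    have "l \<in> {x\<in>X. x < m'}" unfolding l_def using fX X m' by (intro Max_in) auto
    then have l: "l \<in> X" "l < m'" by auto
    have l_max: "e \<le> l" if "e \<in> X" "e < m'" for e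
      unfolding l_def using that fX by (intro Max_ge) auto
    have "uncut P m (m' - 1)"
    proof (rule uncut_consecutive[OF pP nP B(1) m(1) m'(1)])
      show "m < m'" using m m' by simp
      show "e \<le> m \<or> m' \<le> e" if "e \<in> B" for e
        using m_max[OF that] m'_min[OF that] that \<open>j \<notin> B\<close> by (metis linorder_neqE_nat)
    qed
    moreover have "uncut N l (m' - 1)"
      using l_max BX m' by (intro uncut_consecutive[OF pN nN X(1) l(1) _ l(2)]) (auto intro: leI)
    ultimately have "uncut P m l"
      using uncut_mono[OF le] uncut_sym uncut_trans by blast
    then show False using contra l l_max[OF X(3)] m' by blast
  next
    case False
    then have B_less: "e < j" if "e \<in> B" for e
      using that \<open>j \<notin> B\<close> by (metis linorder_neqE_nat)
    define m0 where "m0 = Min B"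
    have m0: "m0 \<in> B" "\<And>e. e \<in> B \<Longrightarrow> m0 \<le> e"
      unfolding m0_def using fB B by (auto intro: Min_in)
    have outer: "uncut P (m0 - 1) m"
      using m0 m_max B_less by (intro uncut_outer[OF pP nP _ B(1) m0(1) m(1)]) auto
    show False
    proof (cases "\<exists>e\<in>X. e < m0")
      case True
      define l where "l = Max {x\<in>X. x < m0}"
      have "l \<in> {x\<in>X. x < m0}" unfolding l_def using fX True by (intro Max_in) auto
      then have l: "l \<in> X" "l < m0" by auto
      have l_max: "e \<le> l" if "e \<in> X" "e < m0" for e
        unfolding l_def using that fX by (intro Max_ge) auto
      have "uncut N l (m0 - 1)"
        using l_max BX m0 by (intro uncut_consecutive[OF pN nN X(1) l(1) _ l(2)]) (auto intro: leI)
      then have "uncut P m l"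
        using outer uncut_mono[OF le] uncut_sym uncut_trans by blast
      moreover have "l < i" using l(2) m0(2)[OF B(2)] by simp
      ultimately show False using contra[OF l(1)] by blast
    next
      case False
      define l where "l = Max X"
      have l: "l \<in> X" unfolding l_def using fX X by (intro Max_in) auto
      have l_max: "e \<le> l" if "e \<in> X" for e
        unfolding l_def using that fX by (intro Max_ge) auto
      have "uncut N (m0 - 1) l"
        using False BX m0 l_max
        by (intro uncut_outer[OF pN nN _ X(1) _ l]) (auto simp: not_less)
      then have "uncut P m l"
        using outer uncut_mono[OF le] uncut_sym uncut_trans by blast
      then show False using contra[OF l] l_max[OF X(3)] by blast
    qed
  qed
qed

lemma linked_iff_uncrossed:
  assumes N: "N \<in> NC n" and P: "P \<in> NC n" and le: "\<forall>a b. linked P a b \<longrightarrow> linked N a b"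
  shows "linked P i j \<longleftrightarrow>
    linked N i j \<and> (\<forall>x y. linked N x y \<and> uncut P x y \<longrightarrow> uncrossed i j x y)"
proof
  assume "linked P i j"
  then show "linked N i j \<and> (\<forall>x y. linked N x y \<and> uncut P x y \<longrightarrow> uncrossed i j x y)"
    using le unfolding uncut_def by blast
next
  assume *: "linked N i j \<and> (\<forall>x y. linked N x y \<and> uncut P x y \<longrightarrow> uncrossed i j x y)"
  have swap: "uncrossed a b x y \<longleftrightarrow> uncrossed b a x y" for a b x y
    unfolding uncrossed_def by argo
  note less = linked_if_uncrossed_less[OF N P le]
  consider "i < j" | "j < i" | "i = j" by linarith
  then show "linked P i j"
  proof cases
    case 1
    then show ?thesis using * less by blast
  next
    case 2
    then have "linked P j i" using * less[of j i] linked_sym swap by blast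
    then show ?thesis by (rule linked_sym)
  next
    case 3
    then show ?thesis
      using * linked_in[OF NC_partition_on[OF N]] linked_refl_iff[OF NC_partition_on[OF P]] by blast
  qed
qed

lemma rel_kreweras_in_NC:
  assumes N: "N \<in> NC n" and P: "P \<in> NC n" and ref: "refines {1..n} P N"
  shows "rel_kreweras N P \<in> NC n" and "refines {1..n} (rel_kreweras N P) N"
proof -
  note part = partition_on_rel_kreweras[OF assms] and link = linked_rel_kreweras[OF assms]
  show "refines {1..n} (rel_kreweras N P) N"
    unfolding refines_iff_linked[OF part NC_partition_on[OF N]] link by blast
  have "noncrossing (rel_kreweras N P)"
    using uncut_convex noncrossing_linkedD[OF NC_partition_on[OF N] NC_noncrossing[OF N]]
    by (intro noncrossingI[OF part]) (auto simp: link)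
  then show "rel_kreweras N P \<in> NC n" using part unfolding NC_def by simp
qed

lemma linked_via_rel_kreweras:
  assumes N: "N \<in> NC n" and P: "P \<in> NC n" and ref: "refines {1..n} P N"
  shows "linked P a b \<longleftrightarrow>
    linked N a b \<and> (\<forall>x y. linked (rel_kreweras N P) x y \<longrightarrow> uncrossed a b x y)"
proof -
  have "\<forall>a b. linked P a b \<longrightarrow> linked N a b"
    using ref refines_iff_linked[OF NC_partition_on[OF P] NC_partition_on[OF N]] by blast
  then show ?thesis
    using linked_iff_uncrossed[OF N P, of a b] unfolding linked_rel_kreweras[OF assms] by blast
qed

lemma rel_kreweras_inject:
  assumes N: "N \<in> NC n" and P: "P \<in> NC n" "refines {1..n} P N" and P': "P' \<in> NC n" "refines {1..n} P' N"
    and eq: "rel_kreweras N P = rel_kreweras N P'"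
  shows "P = P'"
proof (rule partition_on_linked_inject[OF NC_partition_on[OF P(1)] NC_partition_on[OF P'(1)]])
  show "linked P a b \<longleftrightarrow> linked P' a b" for a b
    unfolding linked_via_rel_kreweras[OF N P] linked_via_rel_kreweras[OF N P'] eq ..
qed

text \<open>An injective map of a finite set to itself is surjective.\<close>

lemma rel_kreweras_surj:
  assumes N: "N \<in> NC n" and Q: "Q \<in> NC n" "refines {1..n} Q N"
  obtains P where "P \<in> NC n" "refines {1..n} P N" "rel_kreweras N P = Q"
proof -
  let ?S = "{P \<in> NC n. refines {1..n} P N}"
  have "finite ?S" using finite_NC by simp
  moreover have "rel_kreweras N ` ?S \<subseteq> ?S" using rel_kreweras_in_NC[OF N] by blast
  moreover have "inj_on (rel_kreweras N) ?S"
    by (rule inj_onI) (use rel_kreweras_inject[OF N] in blast)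
  ultimately have "rel_kreweras N ` ?S = ?S" by (rule endo_inj_surj)
  then have "Q \<in> rel_kreweras N ` ?S" using Q by simp
  then show thesis using that by blast
qed

lemma linked_top: "linked {{1..n}} a b \<longleftrightarrow> a \<in> {1..n} \<and> b \<in> {1..n}"
  unfolding linked_def by simp

lemma top_in_NC:
  assumes "n \<ge> 1"
  shows "{{1..n}} \<in> NC n"
  using assms partition_on_space[of "{1..n}"] unfolding NC_def noncrossing_def by simp

lemma refines_top:
  assumes "n \<ge> 1" "P \<in> NC n"
  shows "refines {1..n} P {{1..n}}"
  unfolding refines_iff_linked[OF NC_partition_on[OF assms(2)] NC_partition_on[OF top_in_NC[OF assms(1)]]]
    linked_top
  using linked_in[OF NC_partition_on[OF assms(2)]] by blast

lemma kreweras_eq_rel_kreweras: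
  assumes n: "n \<ge> 1" and P: "P \<in> NC n"
  shows "kreweras n P = rel_kreweras {{1..n}} P"
proof (rule partition_on_linked_inject)
  note top = top_in_NC[OF n] P refines_top[OF n P]
  show "partition_on {1..n} (kreweras n P)" using kreweras_in_NC[OF P] by (rule NC_partition_on)
  show "partition_on {1..n} (rel_kreweras {{1..n}} P)" by (rule partition_on_rel_kreweras[OF top])
  show "linked (kreweras n P) a b \<longleftrightarrow> linked (rel_kreweras {{1..n}} P) a b" for a b
    unfolding linked_kreweras[OF P] linked_rel_kreweras[OF top] linked_top by blast
qed

lemma bij_betw_kreweras:
  assumes n: "n \<ge> 1"
  shows "bij_betw (kreweras n) (NC n) (NC n)"
proof (rule bij_betw_imageI)
  show inj: "inj_on (kreweras n) (NC n)"
    by (rule inj_onI)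
      (use kreweras_eq_rel_kreweras[OF n] rel_kreweras_inject[OF top_in_NC[OF n]] refines_top[OF n] in metis)
  have "kreweras n ` NC n \<subseteq> NC n" using kreweras_in_NC by blast
  then show "kreweras n ` NC n = NC n" by (rule endo_inj_surj[OF finite_NC _ inj])
qed


section \<open>Multichains and noncrossing shuffles\<close>

text \<open>Prolonging a multichain by the top element turns the last component of \<open>\<nabla>\<close>, which is an absolute
complement, into a relative one, so that all components have the same form.\<close>

definition extended :: "nat \<Rightarrow> nat \<Rightarrow> (nat \<Rightarrow> nat set set) \<Rightarrow> nat \<Rightarrow> nat set set" where
  "extended n k P i = (if i \<le> k then P i else {{1..n}})"

text \<open>The components that \<^term>\<open>nabla\<close> shuffles.\<close>

definition delta :: "nat \<Rightarrow> nat \<Rightarrow> (nat \<Rightarrow> nat set set) \<Rightarrow> nat \<Rightarrow> nat set set" where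
  "delta n k P i = (if i < k then rel_kreweras (P (Suc i)) (P i) else kreweras n (P k))"

lemma delta_eq_extended:
  assumes "n \<ge> 1" "P \<in> multichains n k" "i \<in> {1..k}"
  shows "delta n k P i = rel_kreweras (extended n k P (Suc i)) (extended n k P i)"
proof -
  have "P k \<in> NC n" if "k \<ge> 1" using assms(2) that unfolding multichains_def by auto
  then show ?thesis
    using assms(1,3) unfolding delta_def extended_def
    by (cases "i = k") (auto simp: kreweras_eq_rel_kreweras)
qed

lemma extended_NC:
  assumes "n \<ge> 1" "P \<in> multichains n k" "i \<ge> 1"
  shows "extended n k P i \<in> NC n"
proof (cases "i \<le> k")
  case True
  then show ?thesis using assms(2,3) unfolding multichains_def extended_def by auto
next
  case False
  then show ?thesis using top_in_NC[OF assms(1)] unfolding extended_def by simp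
qed

lemma extended_refines_Suc:
  assumes n: "n \<ge> 1" and P: "P \<in> multichains n k" and i: "i \<ge> 1"
  shows "refines {1..n} (extended n k P i) (extended n k P (Suc i))"
proof (cases "i < k")
  case True
  then show ?thesis using P i unfolding multichains_def extended_def by auto
next
  case False
  then show ?thesis
    using refines_top[OF n extended_NC[OF n P i]] unfolding extended_def by simp
qed

lemma extended_refines:
  assumes n: "n \<ge> 1" and P: "P \<in> multichains n k" and i: "i \<ge> 1" and "i \<le> j"
  shows "refines {1..n} (extended n k P i) (extended n k P j)"
  using \<open>i \<le> j\<close>
proof (induction j rule: dec_induct)
  case base
  show ?case using refines_refl NC_partition_on extended_NC[OF n P i] by blast
next
  case (step j)
  then show ?case using refines_trans extended_refines_Suc[OF n P, of j] i by (meson le_trans)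
qed

lemma delta:
  assumes n: "n \<ge> 1" and P: "P \<in> multichains n k" and i: "i \<in> {1..k}"
  shows delta_NC: "delta n k P i \<in> NC n"
    and linked_delta: "linked (delta n k P i) x y \<longleftrightarrow>
      linked (extended n k P (Suc i)) x y \<and> uncut (extended n k P i) x y"
proof -
  have "i \<ge> 1" "Suc i \<ge> 1" using i by auto
  note * = extended_NC[OF n P this(2)] extended_NC[OF n P this(1)]
    extended_refines_Suc[OF n P this(1)]
  show "delta n k P i \<in> NC n"
    unfolding delta_eq_extended[OF assms] by (rule rel_kreweras_in_NC(1)[OF *])
  show "linked (delta n k P i) x y \<longleftrightarrow>
      linked (extended n k P (Suc i)) x y \<and> uncut (extended n k P i) x y"
    unfolding delta_eq_extended[OF assms] by (rule linked_rel_kreweras[OF *])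
qed

text \<open>For \<open>i < j\<close> there is the chain \<open>Q\<^sub>i \<le> P\<^sub>i\<^sub>+\<^sub>1 \<le> P\<^sub>j\<close>, and \<open>Q\<^sub>j \<le> K(P\<^sub>j) \<le> K(Q\<^sub>i)\<close> because \<open>K\<close>
reverses the order.\<close>

lemma shuffle_delta_NC:
  assumes n: "n \<ge> 1" and P: "P \<in> multichains n k"
  shows "shuffle k (delta n k P) \<in> NC (k * n)"
proof -
  have part: "\<forall>i\<in>{1..k}. partition_on {1..n} (delta n k P i)"
    using delta_NC[OF n P] NC_partition_on by blast
  have "uncut (delta n k P i) x y"
    if ij: "i \<in> {1..k}" "j \<in> {1..k}" "i < j" and xy: "linked (delta n k P j) x y" for i j x y
  proof -
    have "refines {1..n} (extended n k P (Suc i)) (extended n k P j)"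
      using ij by (intro extended_refines[OF n P]) auto
    then have "linked (extended n k P j) a b" if "linked (extended n k P (Suc i)) a b" for a b
      using that ij refines_iff_linked NC_partition_on[OF extended_NC[OF n P]]
      by (metis Suc_le_mono atLeastAtMost_iff le_SucI le0 One_nat_def)
    then have "\<forall>a b. linked (delta n k P i) a b \<longrightarrow> linked (extended n k P j) a b"
      unfolding linked_delta[OF n P ij(1)] by blast
    then show ?thesis
      using xy uncut_mono unfolding linked_delta[OF n P ij(2)] by blast
  qed
  then have "noncrossing (shuffle k (delta n k P))"
    unfolding noncrossing_shuffle_iff[OF part] using delta_NC[OF n P] NC_noncrossing by blast
  then show ?thesis using partition_on_shuffle[OF part] unfolding NC_def by simp
qed

lemma linked_shuffle_mod:
  assumes Q: "\<forall>i\<in>{1..k}. partition_on {1..n} (Q i)" and uv: "linked (shuffle k Q) u v"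
  shows "u mod k = v mod k"
proof -
  obtain i a b where i: "i \<in> {1..k}" "u = slot k i a" "v = slot k i b" "linked (Q i) a b"
    using uv unfolding linked_shuffle by blast
  then have "1 \<le> a" "1 \<le> b" using linked_in Q by fastforce+
  then show ?thesis using slot_mod_eq_iff[OF i(1,1), of a b] i(2,3) by blast
qed

lemma shuffle_inject:
  assumes Q: "\<forall>i\<in>{1..k}. partition_on {1..n} (Q i)" and Q': "\<forall>i\<in>{1..k}. partition_on {1..n} (Q' i)"
    and eq: "shuffle k Q = shuffle k Q'" and i: "i \<in> {1..k}"
  shows "Q i = Q' i"
proof (rule partition_on_linked_inject)
  show part: "partition_on {1..n} (Q i)" "partition_on {1..n} (Q' i)" using Q Q' i by blast+
  show "linked (Q i) a b \<longleftrightarrow> linked (Q' i) a b" for a b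
  proof (cases "a \<in> {1..n} \<and> b \<in> {1..n}")
    case True
    then show ?thesis
      using linked_shuffle_slot[OF Q i i, of a b] linked_shuffle_slot[OF Q' i i, of a b]
      unfolding eq by blast
  next
    case False
    then show ?thesis using linked_in[OF part(1)] linked_in[OF part(2)] by blast
  qed
qed

lemma shuffle_exists:
  assumes T: "partition_on {1..k * n} T" and res: "\<And>u v. linked T u v \<Longrightarrow> u mod k = v mod k"
  obtains Q where "\<forall>i\<in>{1..k}. partition_on {1..n} (Q i)" "shuffle k Q = T"
proof
  define Q where "Q i = classes n (\<lambda>a b. linked T (slot k i a) (slot k i b))" for i
  have Q: "partition_on {1..n} (Q i)"
      "linked (Q i) a b \<longleftrightarrow> a \<in> {1..n} \<and> b \<in> {1..n} \<and> linked T (slot k i a) (slot k i b)"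
    if i: "i \<in> {1..k}" for i a b
  proof -
    have refl: "linked T (slot k i a) (slot k i a)" if "a \<in> {1..n}" for a
      using slot_mem[OF i that] linked_refl_iff[OF T] by blast
    show "partition_on {1..n} (Q i)"
      unfolding Q_def by (rule partition_on_classes) (erule refl | erule linked_sym | erule (1) linked_trans[OF T])+
    show "linked (Q i) a b \<longleftrightarrow> a \<in> {1..n} \<and> b \<in> {1..n} \<and> linked T (slot k i a) (slot k i b)"
      unfolding Q_def by (rule linked_classes) (erule refl | erule linked_sym | erule (1) linked_trans[OF T])+
  qed
  show part: "\<forall>i\<in>{1..k}. partition_on {1..n} (Q i)" using Q(1) by blast
  show "shuffle k Q = T"
  proof (rule partition_on_linked_inject[OF partition_on_shuffle[OF part] T])
    fix u v
    show "linked (shuffle k Q) u v \<longleftrightarrow> linked T u v"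
    proof
      assume "linked (shuffle k Q) u v"
      then show "linked T u v" unfolding linked_shuffle using Q(2) by blast
    next
      assume uv: "linked T u v"
      then have "u \<in> {1..k * n}" "v \<in> {1..k * n}" using linked_in[OF T] by blast+
      then obtain i a j b where i: "i \<in> {1..k}" "a \<in> {1..n}" "u = slot k i a"
        and j: "j \<in> {1..k}" "b \<in> {1..n}" "v = slot k j b"
        by (meson slot_exists)
      have "i = j" using res[OF uv] i j slot_mod_eq_iff[of i k j a b] by simp
      then show "linked (shuffle k Q) u v"
        using uv i j Q(2)[OF i(1), of a b] unfolding linked_shuffle by blast
    qed
  qed
qed

text \<open>Downward induction from the top element: \<open>Q\<^sub>i\<close> and \<open>P\<^sub>i\<^sub>+\<^sub>1\<close> determine \<open>P\<^sub>i\<close>.\<close>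

lemma delta_inject:
  assumes n: "n \<ge> 1" and P: "P \<in> multichains n k" and P': "P' \<in> multichains n k"
    and eq: "\<And>i. i \<in> {1..k} \<Longrightarrow> delta n k P i = delta n k P' i"
  shows "P = P'"
proof -
  have ext: "extended n k P i = extended n k P' i" if "i \<le> Suc k" "1 \<le> i" for i
    using that
  proof (induction i rule: inc_induct)
    case base
    show ?case unfolding extended_def by simp
  next
    case (step i)
    then have i: "i \<in> {1..k}" "i \<ge> 1" "Suc i \<ge> 1" by auto
    have same: "extended n k P (Suc i) = extended n k P' (Suc i)" using step by simp
    show ?case
    proof (rule rel_kreweras_inject[OF extended_NC[OF n P i(3)]])
      show "rel_kreweras (extended n k P (Suc i)) (extended n k P i) =
          rel_kreweras (extended n k P (Suc i)) (extended n k P' i)"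
        using eq[OF i(1)] same
        unfolding delta_eq_extended[OF n P i(1)] delta_eq_extended[OF n P' i(1)] by simp
      show "refines {1..n} (extended n k P' i) (extended n k P (Suc i))"
        unfolding same by (rule extended_refines_Suc[OF n P' i(2)])
    qed (use extended_NC[OF n] extended_refines_Suc[OF n] P P' i in blast)+
  qed
  have "P i = P' i" if "i \<in> {1..k}" for i
    using ext[of i] that unfolding extended_def by simp
  moreover have "P \<in> {1..k} \<rightarrow>\<^sub>E NC n" "P' \<in> {1..k} \<rightarrow>\<^sub>E NC n"
    using P P' unfolding multichains_def by blast+
  ultimately show ?thesis by (intro PiE_ext[of P "{1..k}" "\<lambda>_. NC n" P'])
qed

text \<open>The candidate for \<open>P\<^sub>i\<close> is the coarsest partition uncrossed with all of \<open>Q\<^sub>i, \<dots>, Q\<^sub>k\<close>. The hypothesis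
gives \<open>Q\<^sub>i \<le> P\<^sub>i\<^sub>+\<^sub>1\<close>, so \<open>Q\<^sub>i\<close> is the complement relative to \<open>P\<^sub>i\<^sub>+\<^sub>1\<close> of some noncrossing
partition. By \<open>linked_via_rel_kreweras\<close> that partition is the candidate, which is therefore
noncrossing.\<close>

lemma delta_surj:
  assumes n: "n \<ge> 1" and Q: "\<And>i. i \<in> {1..k} \<Longrightarrow> Q i \<in> NC n"
    and uncut: "\<And>i j x y. i \<in> {1..k} \<Longrightarrow> j \<in> {1..k} \<Longrightarrow> i < j \<Longrightarrow> linked (Q j) x y \<Longrightarrow> uncut (Q i) x y"
  obtains P where "P \<in> multichains n k" "\<And>i. i \<in> {1..k} \<Longrightarrow> delta n k P i = Q i"
proof -
  define R where "R i a b \<longleftrightarrow> (\<forall>j\<in>{i..k}. \<forall>x y. linked (Q j) x y \<longrightarrow> uncrossed a b x y)" for i a b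
  define P where "P i = classes n (R i)" for i
  have R: "R i a a" "R i a b \<Longrightarrow> R i b a" "R i a b \<Longrightarrow> R i b c \<Longrightarrow> R i a c" for i a b c
  proof -
    have "uncrossed a a x y" "uncrossed a b x y \<Longrightarrow> uncrossed b a x y"
      "uncrossed a b x y \<Longrightarrow> uncrossed b c x y \<Longrightarrow> uncrossed a c x y" for x y
      unfolding uncrossed_def by argo+
    then show "R i a a" "R i a b \<Longrightarrow> R i b a" "R i a b \<Longrightarrow> R i b c \<Longrightarrow> R i a c"
      unfolding R_def by blast+
  qed
  have part: "partition_on {1..n} (P i)"
    and link: "linked (P i) a b \<longleftrightarrow> a \<in> {1..n} \<and> b \<in> {1..n} \<and> R i a b" for i a b
    unfolding P_def
    by ((rule partition_on_classes linked_classes), (rule R(1) | erule R(2) | erule (1) R(3))+)+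
  have top: "P (Suc k) = {{1..n}}"
    by (rule partition_on_linked_inject[OF part NC_partition_on[OF top_in_NC[OF n]]])
      (simp add: link linked_top R_def del: One_nat_def)
  have ref: "refines {1..n} (P i) (P (Suc i))" for i
  proof -
    have "R (Suc i) a b" if "R i a b" for a b
      using that unfolding R_def by (metis Suc_leD atLeastAtMost_iff)
    then show ?thesis unfolding refines_iff_linked[OF part part] link by blast
  qed
  have one_step: "P i \<in> NC n \<and> rel_kreweras (P (Suc i)) (P i) = Q i"
    if i: "i \<in> {1..k}" and N: "P (Suc i) \<in> NC n" for i
  proof -
    have "linked (P (Suc i)) a b" if "linked (Q i) a b" for a b
      unfolding link R_def
    proof (intro conjI ballI allI impI)
      show "a \<in> {1..n}" "b \<in> {1..n}"
        using linked_in[OF NC_partition_on[OF Q[OF i]] that] by blast+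
      fix j x y assume "j \<in> {Suc i..k}" "linked (Q j) x y"
      then show "uncrossed a b x y" using uncut[of i j x y] i that unfolding uncut_def by simp
    qed
    then have "refines {1..n} (Q i) (P (Suc i))"
      using refines_iff_linked[OF NC_partition_on[OF Q[OF i]] part] by blast
    then obtain P' where P': "P' \<in> NC n" "refines {1..n} P' (P (Suc i))" "rel_kreweras (P (Suc i)) P' = Q i"
      by (rule rel_kreweras_surj[OF N Q[OF i]])
    have "{i..k} = insert i {Suc i..k}" using i by auto
    then have "R i a b \<longleftrightarrow> R (Suc i) a b \<and> (\<forall>x y. linked (Q i) x y \<longrightarrow> uncrossed a b x y)" for a b
      unfolding R_def by auto
    then have "linked P' a b \<longleftrightarrow> linked (P i) a b" for a b
      unfolding linked_via_rel_kreweras[OF N P'(1,2)] P'(3) link by blast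
    then have "P' = P i"
      by (rule partition_on_linked_inject[OF NC_partition_on[OF P'(1)] part])
    then show ?thesis using P' by blast
  qed
  have NC: "P i \<in> NC n" if "i \<le> Suc k" "1 \<le> i" for i
    using that
  proof (induction i rule: inc_induct)
    case base
    show ?case using top top_in_NC[OF n] by simp
  next
    case (step i)
    then show ?case using one_step[of i] by simp
  qed
  define P' where "P' = restrict P {1..k}"
  have chain: "P' \<in> multichains n k"
    unfolding multichains_def P'_def using NC ref by auto
  moreover have "delta n k P' i = Q i" if i: "i \<in> {1..k}" for i
  proof -
    have "extended n k P' j = P j" if "1 \<le> j" "j \<le> Suc k" for j
      using that top unfolding extended_def P'_def by (auto simp: le_Suc_eq)
    then show ?thesis
      using one_step[OF i] NC[of "Suc i"] i unfolding delta_eq_extended[OF n chain i] by simp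
  qed
  ultimately show thesis using that by blast
qed

lemma bij_betw_shuffle_delta:
  assumes n: "n \<ge> 1"
  shows "bij_betw (\<lambda>P. shuffle k (delta n k P)) (multichains n k)
    {T \<in> NC (k * n). \<forall>u v. linked T u v \<longrightarrow> u mod k = v mod k}"
proof (rule bij_betw_imageI)
  have part: "\<forall>i\<in>{1..k}. partition_on {1..n} (delta n k P i)" if "P \<in> multichains n k" for P
    using delta_NC[OF n that] NC_partition_on by blast
  show "inj_on (\<lambda>P. shuffle k (delta n k P)) (multichains n k)"
  proof (rule inj_onI)
    fix P P' assume P: "P \<in> multichains n k" "P' \<in> multichains n k"
      and eq: "shuffle k (delta n k P) = shuffle k (delta n k P')"
    show "P = P'"
      by (rule delta_inject[OF n P]) (rule shuffle_inject[OF part[OF P(1)] part[OF P(2)] eq])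
  qed
  show "(\<lambda>P. shuffle k (delta n k P)) ` multichains n k =
      {T \<in> NC (k * n). \<forall>u v. linked T u v \<longrightarrow> u mod k = v mod k}" (is "?f ` _ = ?T")
  proof (intro equalityI subsetI)
    fix T assume "T \<in> ?f ` multichains n k"
    then show "T \<in> ?T" using shuffle_delta_NC[OF n] linked_shuffle_mod[OF part] by blast
  next
    fix T assume T: "T \<in> ?T"
    then obtain Q where Q: "\<forall>i\<in>{1..k}. partition_on {1..n} (Q i)" "shuffle k Q = T"
      using shuffle_exists[of k n T] NC_partition_on by blast
    have nc: "noncrossing (shuffle k Q)" using T Q(2) NC_noncrossing by blast
    note nc' = nc[unfolded noncrossing_shuffle_iff[OF Q(1)]]
    have Q_NC: "Q i \<in> NC n" if "i \<in> {1..k}" for i using nc' Q(1) that unfolding NC_def by blast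
    obtain P where P: "P \<in> multichains n k" "\<And>i. i \<in> {1..k} \<Longrightarrow> delta n k P i = Q i"
      by (rule delta_surj[OF n Q_NC, of k]) (use nc' in blast)+
    then have "?f P = T" unfolding Q(2)[symmetric] shuffle_def by simp
    then show "T \<in> ?f ` multichains n k" using P(1) by blast
  qed
qed


section \<open>Divisibility of block sizes\<close>

text \<open>The points between two linked gaps form a union of blocks.\<close>

lemma mod_eq_if_divisible_blocks:
  assumes P: "P \<in> NC m" and div: "divisible_blocks k P" and xy: "uncut P x y"
    and le: "x \<le> y" "y \<le> m"
  shows "x mod k = y mod k"
proof -
  note part = NC_partition_on[OF P]
  let ?C = "{B \<in> P. B \<subseteq> {x<..y}}"
  have "\<Union>?C = {x<..y}"
  proof (intro equalityI subsetI)
    fix a assume a: "a \<in> {x<..y}"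
    then have "a \<in> {1..m}" using le by simp
    then obtain B where B: "B \<in> P" "a \<in> B" using partition_onD1[OF part] by blast
    have "b \<in> {x<..y}" if "b \<in> B" for b
    proof -
      have "uncrossed a b x y" using xy linkedI[OF B that] unfolding uncut_def by blast
      then show ?thesis
        using a le(1) unfolding uncrossed_def greaterThanAtMost_iff by linarith
    qed
    then show "a \<in> \<Union>?C" using B by blast
  qed blast
  moreover have "k dvd card (\<Union>?C)"
  proof (rule dvd_partition)
    show "finite (\<Union>?C)" by (rule finite_subset[of _ "{x<..y}"]) auto
    show "\<forall>c\<in>?C. k dvd card c" using div unfolding divisible_blocks_def by blast
    show "\<forall>c1\<in>?C. \<forall>c2\<in>?C. c1 \<noteq> c2 \<longrightarrow> c1 \<inter> c2 = {}"
      using partition_onD2[OF part] unfolding disjoint_def by blast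
  qed
  ultimately have "k dvd y - x" by simp
  then show ?thesis using le(1) mod_eq_dvd_iff_nat by metis
qed

lemma uncut_full:
  assumes "partition_on {1..m} P"
  shows "uncut P 0 m"
  unfolding uncut_def uncrossed_def using linked_in[OF assms] by auto

text \<open>Each step from an element of a block to the next one is \<open>1\<close> modulo \<open>k\<close>, since the gap after the
former is linked with the gap before the latter. This includes the step from the last element to
the first one. Going once around the circle adds up to \<open>m\<close>, which is \<open>0\<close> modulo \<open>k\<close>, so the number
of elements is \<open>0\<close> modulo \<open>k\<close>.\<close>

lemma divisible_blocks_if_mod_eq:
  assumes P: "P \<in> NC m" and k: "k dvd m"
    and res: "\<And>x y. linked (kreweras m P) x y \<Longrightarrow> x mod k = y mod k"
  shows "divisible_blocks k P"
  unfolding divisible_blocks_def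
proof
  note part = NC_partition_on[OF P] and nc = NC_noncrossing[OF P]
  fix B assume B: "B \<in> P"
  have sub: "B \<subseteq> {1..m}" using B partition_onD1[OF part] by blast
  then have fin: "finite B" by (rule finite_subset) simp
  have "B \<noteq> {}" using B partition_onD3[OF part] by blast
  \<comment> \<open>The gap \<open>0\<close> is not an element of \<open>[m]\<close>, but is equivalent to the gap \<open>m\<close>, and \<open>k\<close> divides \<open>m\<close>.\<close>
  have res': "x mod k = y mod k" if "uncut P x y" "x \<le> m" "y \<in> {1..m}" for x y
  proof (cases "x = 0")
    case True
    have "uncut P m y" using that(1) uncut_full[OF part] True uncut_sym uncut_trans by blast
    then have "m mod k = y mod k"
      using that(3) by (intro res) (auto simp: linked_kreweras[OF P])
    then show ?thesis using True k by simp
  next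
    case False
    then show ?thesis using that by (intro res) (auto simp: linked_kreweras[OF P])
  qed
  define c d where "c = Min B" and "d = Max B"
  have cd: "c \<in> B" "d \<in> B" "\<And>e. e \<in> B \<Longrightarrow> c \<le> e \<and> e \<le> d"
    unfolding c_def d_def using fin \<open>B \<noteq> {}\<close> by auto
  have count: "e mod k = (c + card {b\<in>B. b < e}) mod k" if "e \<in> B" for e
    using that
  proof (induction e rule: less_induct)
    case (less e)
    show ?case
    proof (cases "e = c")
      case True
      then have "{b\<in>B. b < e} = {}" using cd(3) by fastforce
      then have "card {b\<in>B. b < e} = 0" by (simp only: card.empty)
      then show ?thesis by (simp only: True add_0_right)
    next
      case False
      define p where "p = Max {b\<in>B. b < e}"
      have "c < e" using False cd(3)[OF less.prems] by simp
      then have "p \<in> {b\<in>B. b < e}" unfolding p_def using fin cd(1) by (intro Max_in) auto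
      then have p: "p \<in> B" "p < e" by auto
      have p_max: "b \<le> p" if "b \<in> B" "b < e" for b
        unfolding p_def using that fin by (intro Max_ge) auto
      have "uncut P p (e - 1)"
        using p_max by (intro uncut_consecutive[OF part nc B p(1) less.prems p(2)]) (auto intro: leI)
      then have "p mod k = (e - 1) mod k"
        using subsetD[OF sub p(1)] subsetD[OF sub less.prems] p(2) by (intro res') auto
      then have "Suc p mod k = Suc (e - 1) mod k"
        by (metis mod_Suc_eq)
      then have "Suc p mod k = e mod k"
        using p(2) by simp
      moreover have "{b\<in>B. b < e} = insert p {b\<in>B. b < p}"
        using p p_max by (fastforce simp: le_less)
      then have "card {b\<in>B. b < e} = Suc (card {b\<in>B. b < p})"
        using fin by simp
      moreover have "Suc p mod k = Suc (c + card {b\<in>B. b < p}) mod k"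
        using less.IH[OF p(2,1)] by (metis mod_Suc_eq)
      ultimately show ?thesis by simp
    qed
  qed
  have "B = insert d {b\<in>B. b < d}" using cd(2,3) by (auto simp: le_less)
  then have "card B = card (insert d {b\<in>B. b < d})" by (rule arg_cong)
  also have "\<dots> = Suc (card {b\<in>B. b < d})" using fin by simp
  finally have card: "card B = Suc (card {b\<in>B. b < d})" .
  have c: "c \<ge> 1" and dm: "d \<le> m" "c \<le> d" using subsetD[OF sub cd(1)] subsetD[OF sub cd(2)] cd(3)[OF cd(2)] by auto
  have "uncut P (c - 1) d"
    using cd(3) by (intro uncut_outer[OF part nc _ B cd(1,2)]) auto
  then have "(c - 1) mod k = d mod k"
    using c dm by (intro res') auto
  also have "\<dots> = (c - 1 + card B) mod k"
    using count[OF cd(2)] c card by simp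
  finally have "k dvd (c - 1 + card B) - (c - 1)"
    by (metis le_add1 mod_eq_dvd_iff_nat)
  then show "k dvd card B" by simp
qed

lemma divisible_blocks_iff_kreweras:
  assumes P: "P \<in> NC m" and k: "k dvd m"
  shows "divisible_blocks k P \<longleftrightarrow> (\<forall>x y. linked (kreweras m P) x y \<longrightarrow> x mod k = y mod k)"
proof
  assume div: "divisible_blocks k P"
  show "\<forall>x y. linked (kreweras m P) x y \<longrightarrow> x mod k = y mod k"
  proof (intro allI impI)
    fix x y assume "linked (kreweras m P) x y"
    then have *: "x \<le> m" "y \<le> m" "uncut P x y" unfolding linked_kreweras[OF P] by auto
    then show "x mod k = y mod k"
      using mod_eq_if_divisible_blocks[OF P div *(3) _ *(2)]
        mod_eq_if_divisible_blocks[OF P div uncut_sym[OF *(3)] _ *(1)] nat_le_linear by metis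
  qed
qed (use divisible_blocks_if_mod_eq[OF P k] in blast)


theorem corollary4p3p9:
  fixes n k :: nat
  assumes "n \<ge> 1" and "k \<ge> 1"
  shows "bij_betw (nabla n k) (multichains n k) {P \<in> NC (k * n). divisible_blocks k P}"
proof -
  let ?D = "{P \<in> NC (k * n). divisible_blocks k P}"
    and ?T = "{T \<in> NC (k * n). \<forall>u v. linked T u v \<longrightarrow> u mod k = v mod k}"
  have "k * n \<ge> 1" using assms by simp
  then have K: "bij_betw (kreweras (k * n)) (NC (k * n)) (NC (k * n))" by (rule bij_betw_kreweras)
  have iff: "kreweras (k * n) P \<in> ?T \<longleftrightarrow> P \<in> ?D" if "P \<in> NC (k * n)" for P
    using divisible_blocks_iff_kreweras[OF that, of k] kreweras_in_NC[OF that] that by simp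
  have "kreweras (k * n) ` ?D = ?T"
  proof (intro equalityI subsetI)
    fix T assume T: "T \<in> ?T"
    then have "T \<in> NC (k * n)" by simp
    then have "T \<in> kreweras (k * n) ` NC (k * n)"
      unfolding bij_betw_imp_surj_on[OF K] .
    then obtain P where P: "P \<in> NC (k * n)" "T = kreweras (k * n) P" by (rule imageE)
    then have "P \<in> ?D" using iff T by simp
    then show "T \<in> kreweras (k * n) ` ?D" unfolding P(2) by (rule imageI)
  next
    fix T assume "T \<in> kreweras (k * n) ` ?D"
    then obtain P where P: "P \<in> ?D" "T = kreweras (k * n) P" by (rule imageE)
    then have "P \<in> NC (k * n)" by simp
    then show "T \<in> ?T" using iff P by simp
  qed
  then have "bij_betw (kreweras_inv (k * n)) ?T ?D"
    unfolding kreweras_inv_def by (intro bij_betw_inv_into_subset[OF K]) auto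
  from bij_betw_trans[OF bij_betw_shuffle_delta[OF assms(1)] this]
  show ?thesis
    unfolding nabla_def[abs_def] delta_def[abs_def] comp_def .
qed

end
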